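(* Let $X$ be a normed linear space and let $\varepsilon,\delta\in[0,1)$ be such that $\varepsilon<(1-\delta)^2$. Then for any $x,y\in X\setminus\{0\}$, one has $x\perp_\delta^\varepsilon y$ if and only if there exists $z\in\operatorname{span}\{x,y\}$ such that $x\perp_\delta^0 z$ and $\|z-y\|\le\frac{\varepsilon}{1-\delta}\|y\|$.
   Context: All normed linear spaces are over $\mathbb{C}$. $X^*$ is the topological dual of $X$. For $\delta,\varepsilon\in[0,1)$ with $\varepsilon<(1-\delta)^2$ and $x,y\in X$, one writes $x\perp_\delta^\varepsilon y$ if there exists $f\in X^*\setminus\{0\}$ with $|f(x)|\ge(1-\delta)\|f\|\|x\|$ and $|f(y)|\le\frac{\varepsilon}{1-\delta}\|f\|\|y\|$. In particular ($\varepsilon=0$), $x\perp_\delta^0 z$ means that there exists $f\in X^*\setminus\{0\}$ with $|f(x)|\ge(1-\delta)\|f\|\|x\|$ and $f(z)=0$. *)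

theory Defs
  imports "HOL-Analysis.Analysis"
begin

text \<open>
  A normed linear space over the complex numbers: a real normed space with a complex
  scalar multiplication that extends the real one and for which the norm is homogeneous.
\<close>

class complex_normed_vector = real_normed_vector +
  fixes scaleC :: "complex \<Rightarrow> 'a \<Rightarrow> 'a" (infixr "*\<^sub>C" 75)
  assumes scaleC_add_right: "a *\<^sub>C (x + y) = a *\<^sub>C x + a *\<^sub>C y"
    and scaleC_add_left: "(a + b) *\<^sub>C x = a *\<^sub>C x + b *\<^sub>C x"
    and scaleC_scaleC: "a *\<^sub>C (b *\<^sub>C x) = (a * b) *\<^sub>C x"
    and scaleR_scaleC: "r *\<^sub>R x = complex_of_real r *\<^sub>C x"
    and norm_scaleC: "norm (a *\<^sub>C x) = cmod a * norm x"

global_interpretation complex_vector: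
  vector_space "scaleC :: complex \<Rightarrow> 'a \<Rightarrow> 'a::complex_normed_vector"
proof
  fix x :: 'a
  show "1 *\<^sub>C x = x"
    using scaleR_scaleC[of 1 x] by simp
qed (simp_all add: scaleC_add_right scaleC_add_left scaleC_scaleC)

instantiation complex :: complex_normed_vector
begin

definition scaleC_complex :: "complex \<Rightarrow> complex \<Rightarrow> complex"
  where "scaleC_complex = (*)"

instance
  by standard
    (simp_all add: scaleC_complex_def algebra_simps norm_mult scaleR_conv_of_real)

end

text \<open>The topological dual; its norm is \<^const>\<open>onorm\<close>.\<close>

definition dual :: "('a::complex_normed_vector \<Rightarrow> complex) set"
  where "dual = {f. bounded_linear f \<and> Vector_Spaces.linear scaleC (*) f}"

text \<open>
  The relation is meant for \<open>\<delta>, \<epsilon> \<in> [0, 1)\<close> with \<open>\<epsilon> < (1 - \<delta>)\<^sup>2\<close>; these conditions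
  are left to the statements that use it.
\<close>

definition approx_orth :: "real \<Rightarrow> real \<Rightarrow> 'a::complex_normed_vector \<Rightarrow> 'a \<Rightarrow> bool"
  where "approx_orth \<delta> \<epsilon> x y \<longleftrightarrow>
    (\<exists>f\<in>dual - {\<lambda>_. 0}.
      cmod (f x) \<ge> (1 - \<delta>) * onorm f * norm x \<and>
      cmod (f y) \<le> \<epsilon> / (1 - \<delta>) * onorm f * norm y)"

end

theory Submission
  imports Defs
begin

text \<open>
  Write \<open>\<eta> = \<epsilon> / (1 - \<delta>)\<close>. If \<open>f\<close> witnesses \<open>x \<perp> z\<close> and \<open>\<parallel>z - y\<parallel> \<le> \<eta> \<parallel>y\<parallel>\<close>, then
  \<open>f y = - f (z - y)\<close> is small, so the same \<open>f\<close> witnesses the approximate orthogonality of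
  \<open>x\<close> and \<open>y\<close>.

  For the converse let \<open>f\<close> have norm 1, with \<open>|f x| \<ge> (1 - \<delta>) \<parallel>x\<parallel>\<close> and \<open>|f y| \<le> \<eta> \<parallel>y\<parallel>\<close>.
  Subtracting a multiple of \<open>x\<close> from \<open>y\<close> to reach the kernel of \<open>f\<close> moves \<open>y\<close> by up to
  \<open>\<eta> \<parallel>y\<parallel> / (1 - \<delta>)\<close>, which is too far. One should subtract a multiple of a vector \<open>u\<close> of the plane
  spanned by \<open>x\<close> and \<open>y\<close> at which \<open>f\<close> attains its norm: \<open>z = y - (f y / f u) u\<close> is
  at distance exactly \<open>|f y|\<close> from \<open>y\<close>. Such a \<open>u\<close> need not exist, because \<open>f\<close> may have norm less than 1
  on the plane. The condition \<open>\<epsilon> < (1 - \<delta>)\<^sup>2\<close> forces \<open>x\<close> and \<open>y\<close> to be linearly independent, so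
  there is freedom to replace \<open>f\<close> on the plane by the functional that has the same value at \<open>y\<close>
  and the value \<open>t f x\<close> at \<open>x\<close>. This only helps the lower bound at \<open>x\<close>, and for the largest
  \<open>t \<ge> 1\<close> for which its norm is still at most 1, compactness shows that it attains norm 1 at some
  \<open>u\<close> (\<open>enlarge_functional_on_plane\<close>).

  The new functional \<open>g\<close> lives on the plane only and vanishes at \<open>z\<close>. What it says about the whole
  space is that \<open>\<parallel>x - k z\<parallel> \<ge> |g x| \<ge> (1 - \<delta>) \<parallel>x\<parallel>\<close> for every scalar \<open>k\<close>: the line through \<open>z\<close> is
  far from \<open>x\<close> (\<open>exists_near_far_from_line\<close>). By the Hahn-Banach theorem, applied to the
  distance to that line, this is enough for \<open>x \<perp> z\<close> (\<open>approx_orth_zero_if_far_from_line\<close>).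
\<close>

section \<open>The Hahn-Banach theorem for seminorms\<close>

definition sublinear :: "('a::real_vector \<Rightarrow> real) \<Rightarrow> bool"
  where "sublinear q \<longleftrightarrow>
    (\<forall>v w. q (v + w) \<le> q v + q w) \<and> (\<forall>r v. 0 \<le> r \<longrightarrow> q (r *\<^sub>R v) \<le> r * q v)"

lemma sublinear_add: "sublinear q \<Longrightarrow> q (v + w) \<le> q v + q w"
  by (simp add: sublinear_def)

lemma sublinear_scale_le: "sublinear q \<Longrightarrow> 0 \<le> r \<Longrightarrow> q (r *\<^sub>R v) \<le> r * q v"
  by (simp add: sublinear_def)

lemma sublinear_zero:
  assumes "sublinear q"
  shows "q 0 = 0"
  using sublinear_scale_le[OF assms, of 0 0] sublinear_add[OF assms, of 0 0] by simp

lemma sublinear_scale: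
  assumes "sublinear q" and "0 \<le> r"
  shows "q (r *\<^sub>R v) = r * q v"
proof (cases "r = 0")
  case True
  then show ?thesis
    using sublinear_zero[OF assms(1)] by simp
next
  case False
  then have "q v \<le> inverse r * q (r *\<^sub>R v)"
    using sublinear_scale_le[OF assms(1), of "inverse r" "r *\<^sub>R v"] assms(2) by simp
  then have "r * q v \<le> q (r *\<^sub>R v)"
    using False assms(2) by (simp add: field_simps)
  then show ?thesis
    using sublinear_scale_le[OF assms] by (simp add: antisym)
qed

lemma sublinear_minus:
  assumes "sublinear q"
  shows "- q (- v) \<le> q v"
  using sublinear_add[OF assms, of v "- v"] sublinear_zero[OF assms] by simp

lemma le_cINF_add_cINF:
  fixes f :: "'i \<Rightarrow> real" and g :: "'j \<Rightarrow> real"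
  assumes "A \<noteq> {}" and "B \<noteq> {}" and "\<And>i j. i \<in> A \<Longrightarrow> j \<in> B \<Longrightarrow> c \<le> f i + g j"
  shows "c \<le> (INF i\<in>A. f i) + (INF j\<in>B. g j)"
proof -
  have "c - f i \<le> (INF j\<in>B. g j)" if "i \<in> A" for i
    using assms(2) assms(3)[OF that] by (intro cINF_greatest) (auto simp: algebra_simps)
  then have "c - (INF j\<in>B. g j) \<le> (INF i\<in>A. f i)"
    using assms(1) by (intro cINF_greatest) (auto simp: algebra_simps)
  then show ?thesis by simp
qed

lemma le_mult_cINF:
  fixes f :: "'i \<Rightarrow> real"
  assumes "A \<noteq> {}" and "0 \<le> r" and "bdd_below (f ` A)" and "\<And>i. i \<in> A \<Longrightarrow> c \<le> r * f i"
  shows "c \<le> r * (INF i\<in>A. f i)"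
proof (cases "r = 0")
  case True
  then show ?thesis
    using assms by auto
next
  case False
  then have "0 < r"
    using assms(2) by simp
  then have "c / r \<le> (INF i\<in>A. f i)"
    using assms by (intro cINF_greatest) (auto simp: field_simps)
  then show ?thesis
    using \<open>0 < r\<close> by (simp add: field_simps)
qed

text \<open>
  Follow \<open>q\<close> along the ray from \<open>v\<close> in direction \<open>a\<close>, subtract its growth rate \<open>q a\<close>, and take
  the infimum. At \<open>- a\<close> the ray meets the origin at time 1, hence the bound \<open>- q a\<close>. The lemma serves
  twice: a minimal sublinear functional cannot be lowered, so it is odd; and lowering the given bound
  at \<open>- a\<close> before minimising fixes the value of the resulting linear functional at \<open>a\<close>.
\<close>

lemma sublinear_lower_at_uminus:
  assumes "sublinear q"
  obtains q' where "sublinear q'" and "q' \<le> q" and "q' (- a) \<le> - q a"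
proof -
  define f where "f v t = q (v + t *\<^sub>R a) - t * q a" for v t
  define q' where "q' v = (INF t\<in>{0..}. f v t)" for v
  have "- q (- v) \<le> f v t" if "0 \<le> t" for v t
    using sublinear_add[OF assms, of "v + t *\<^sub>R a" "- v"] sublinear_scale[OF assms that, of a]
    by (simp add: f_def)
  then have bdd: "bdd_below (f v ` {0..})" for v
    by (intro bdd_belowI2[of _ "- q (- v)"]) auto
  have le: "q' v \<le> f v t" if "0 \<le> t" for v t
    unfolding q'_def using bdd that by (intro cINF_lower) auto
  have "q' (v + w) \<le> q' v + q' w" for v w
    unfolding q'_def[of v] q'_def[of w]
  proof (rule le_cINF_add_cINF)
    fix s t :: real
    assume "s \<in> {0..}" and "t \<in> {0..}"
    then have "q' (v + w) \<le> f (v + w) (s + t)"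
      by (intro le) auto
    also have "\<dots> \<le> f v s + f w t"
      using sublinear_add[OF assms, of "v + s *\<^sub>R a" "w + t *\<^sub>R a"]
      by (simp add: f_def algebra_simps)
    finally show "q' (v + w) \<le> f v s + f w t" .
  qed auto
  moreover have "q' (r *\<^sub>R v) \<le> r * q' v" if "0 \<le> r" for r v
    unfolding q'_def[of v]
  proof (rule le_mult_cINF)
    fix t :: real
    assume "t \<in> {0..}"
    then have "q' (r *\<^sub>R v) \<le> f (r *\<^sub>R v) (r * t)"
      using that by (intro le) auto
    also have "\<dots> = r * f v t"
      using sublinear_scale[OF assms that, of "v + t *\<^sub>R a"]
      by (simp add: f_def algebra_simps)
    finally show "q' (r *\<^sub>R v) \<le> r * f v t" .
  qed (use that bdd in auto)
  ultimately have "sublinear q'"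
    by (simp add: sublinear_def)
  moreover have "q' \<le> q"
    using le[of 0] by (simp add: le_fun_def f_def)
  moreover have "q' (- a) \<le> - q a"
    using le[of 1 "- a"] sublinear_zero[OF assms] by (simp add: f_def)
  ultimately show thesis
    using that by blast
qed

text \<open>
  The pointwise infimum of the chain is the bound. It is finite since \<open>q v \<ge> - p (- v)\<close> for each
  member \<open>q\<close>. Subadditivity compares values of two members at two points, and this is where
  the chain condition enters: the smaller member serves at both points.
\<close>

lemma sublinear_INF_chain:
  fixes C :: "('a::real_vector \<Rightarrow> real) set"
  assumes "C \<noteq> {}" and sub: "\<And>q. q \<in> C \<Longrightarrow> sublinear q \<and> q \<le> p"
    and total: "\<And>q q'. q \<in> C \<Longrightarrow> q' \<in> C \<Longrightarrow> q \<le> q' \<or> q' \<le> q"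
  shows "\<exists>u. sublinear u \<and> (\<forall>q\<in>C. u \<le> q)"
proof -
  define u where "u v = (INF q\<in>C. q v)" for v
  have "- p (- v) \<le> q v" if "q \<in> C" for q v
    using sublinear_minus[of q v] sub[OF that] le_funD[of q p "- v"] by fastforce
  then have bdd: "bdd_below ((\<lambda>q. q v) ` C)" for v
    by (intro bdd_belowI2[of _ "- p (- v)"]) auto
  have le: "u v \<le> q v" if "q \<in> C" for q v
    unfolding u_def using bdd that by (intro cINF_lower) auto
  have "u (v + w) \<le> u v + u w" for v w
    unfolding u_def[of v] u_def[of w]
  proof (rule le_cINF_add_cINF)
    fix q q'
    assume "q \<in> C" and "q' \<in> C"
    then obtain q'' where "q'' \<in> C" and "q'' \<le> q" and "q'' \<le> q'"
      using total by blast
    then show "u (v + w) \<le> q v + q' w"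
      using le[of q'' "v + w"] sub[of q''] sublinear_add[of q'' v w]
        le_funD[of q'' q v] le_funD[of q'' q' w] by fastforce
  qed (use assms(1) in auto)
  moreover have "u (r *\<^sub>R v) \<le> r * u v" if "0 \<le> r" for r v
    unfolding u_def[of v]
  proof (rule le_mult_cINF)
    fix q
    assume "q \<in> C"
    then show "u (r *\<^sub>R v) \<le> r * q v"
      using le[of q "r *\<^sub>R v"] sub[of q] sublinear_scale_le[of q r v] that by fastforce
  qed (use that assms(1) bdd in auto)
  ultimately have "sublinear u"
    by (simp add: sublinear_def)
  moreover have "u \<le> q" if "q \<in> C" for q
    using le[OF that] by (simp add: le_fun_def)
  ultimately show ?thesis
    by blast
qed

lemma exists_minimal_sublinear:
  fixes p :: "'a::real_vector \<Rightarrow> real"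
  assumes "sublinear p"
  shows "\<exists>q. sublinear q \<and> q \<le> p \<and> (\<forall>q'. sublinear q' \<longrightarrow> q' \<le> q \<longrightarrow> q' = q)"
proof -
  define A where "A = {q. sublinear q \<and> q \<le> p}"
  have "\<exists>m\<in>A. \<forall>q\<in>A. m \<ge> q \<longrightarrow> q = m"
  proof (rule predicate_Zorn)
    show "partial_order_on A (relation_of (\<ge>) A)"
      by (rule partial_order_on_relation_ofI) auto
    fix C
    assume C: "C \<in> Chains (relation_of (\<ge>) A)"
    then have CA: "C \<subseteq> A"
      using Chains_relation_of by blast
    show "\<exists>u\<in>A. \<forall>q\<in>C. q \<ge> u"
    proof (cases "C = {}")
      case True
      then show ?thesis
        using assms by (auto simp: A_def)
    next
      case False
      have total: "q \<le> q' \<or> q' \<le> q" if "q \<in> C" "q' \<in> C" for q q'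
        using C that by (auto simp: Chains_def relation_of_def)
      have sub: "sublinear q \<and> q \<le> p" if "q \<in> C" for q
        using CA that by (auto simp: A_def)
      have "\<exists>u. sublinear u \<and> (\<forall>q\<in>C. u \<le> q)"
        by (rule sublinear_INF_chain[OF False sub total])
      then obtain u where "sublinear u" and lower: "\<forall>q\<in>C. u \<le> q"
        by blast
      moreover obtain q where "q \<in> C"
        using False by blast
      ultimately have "u \<in> A"
        using lower sub[of q] order_trans[of u q p] by (simp add: A_def)
      then show ?thesis
        using lower by blast
    qed
  qed
  then obtain m where m: "sublinear m" "m \<le> p"
    and minimal: "\<forall>q. sublinear q \<and> q \<le> p \<longrightarrow> q \<le> m \<longrightarrow> q = m"
    by (auto simp: A_def)
  have "q = m" if "sublinear q" "q \<le> m" for q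
    using minimal that order_trans[OF that(2) m(2)] by simp
  with m show ?thesis
    by blast
qed

text \<open>
  Minimal sublinear functionals are linear: they are odd, and oddness turns subadditivity into
  additivity. Minimising below a bound keeps all functions total, in contrast to extending a
  functional from subspace to subspace.
\<close>

theorem Hahn_Banach_sublinear:
  fixes p :: "'a::real_vector \<Rightarrow> real"
  assumes "sublinear p"
  shows "\<exists>L. linear L \<and> (\<forall>v. L v \<le> p v) \<and> L a = p a"
proof -
  obtain p' where p': "sublinear p'" "p' \<le> p" "p' (- a) \<le> - p a"
    using sublinear_lower_at_uminus[OF assms] by blast
  obtain q where q: "sublinear q" "q \<le> p'"
    and minimal: "\<forall>q'. sublinear q' \<longrightarrow> q' \<le> q \<longrightarrow> q' = q"
    using exists_minimal_sublinear[OF p'(1)] by blast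
  have odd: "q (- v) = - q v" for v
  proof (rule antisym)
    obtain q' where "sublinear q'" and "q' \<le> q" and "q' (- v) \<le> - q v"
      using sublinear_lower_at_uminus[OF q(1)] by blast
    then show "q (- v) \<le> - q v"
      using minimal by blast
    show "- q v \<le> q (- v)"
      using sublinear_minus[OF q(1), of v] by simp
  qed
  have "linear q"
  proof (rule linearI)
    fix v w
    show "q (v + w) = q v + q w"
      using sublinear_add[OF q(1), of v w] sublinear_add[OF q(1), of "v + w" "- w"] odd[of w]
      by simp
  next
    fix r v
    show "q (r *\<^sub>R v) = r *\<^sub>R q v"
      using sublinear_scale[OF q(1), of r v] sublinear_scale[OF q(1), of "- r" v] odd[of "r *\<^sub>R v"]
      by (cases "0 \<le> r") auto
  qed
  moreover have le: "q v \<le> p v" for v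
    using q(2) p'(2) by (meson le_funD order_trans)
  moreover have "q a = p a"
    using le[of a] le_funD[OF q(2), of "- a"] p'(3) odd[of a] by simp
  ultimately show ?thesis
    by blast
qed

text \<open>
  A complex linear functional is determined by its real part \<open>L\<close>, as \<open>F v = L v - \<i> L (\<i> v)\<close>, and
  a seminorm that dominates \<open>L\<close> also dominates \<open>|F|\<close>, since it does not see rotations of \<open>v\<close>.
\<close>

theorem Hahn_Banach_seminorm:
  fixes p :: "'a::complex_normed_vector \<Rightarrow> real"
  assumes add: "\<And>v w. p (v + w) \<le> p v + p w"
    and scale: "\<And>c v. p (c *\<^sub>C v) \<le> cmod c * p v"
  shows "\<exists>F. Vector_Spaces.linear scaleC (*) F \<and> (\<forall>v. cmod (F v) \<le> p v) \<and> F a = p a"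
proof -
  have "p (r *\<^sub>R v) \<le> r * p v" if "0 \<le> r" for r v
    using scale[of "of_real r" v] that by (simp add: scaleR_scaleC)
  with add have "sublinear p"
    by (simp add: sublinear_def)
  then obtain L where L: "linear L" "\<forall>v. L v \<le> p v" "L a = p a"
    using Hahn_Banach_sublinear[of p a] by blast
  define F where "F v = Complex (L v) (- L (\<i> *\<^sub>C v))" for v
  have F_add: "F (v + w) = F v + F w" for v w
    by (simp add: F_def scaleC_add_right linear_add[OF L(1)] complex_eq_iff)
  have L_scale: "L (c *\<^sub>C v) = Re c * L v + Im c * L (\<i> *\<^sub>C v)" for c v
  proof -
    have "c *\<^sub>C v = Re c *\<^sub>R v + Im c *\<^sub>R (\<i> *\<^sub>C v)"
      unfolding scaleR_scaleC scaleC_scaleC scaleC_add_left[symmetric]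
      by (rule arg_cong[where f = "\<lambda>a. a *\<^sub>C v"]) (simp add: complex_eq_iff)
    then show ?thesis
      by (simp add: linear_add[OF L(1)] linear_scale[OF L(1)])
  qed
  have F_scale: "F (c *\<^sub>C v) = c * F v" for c v
    using L_scale[of c v] L_scale[of "\<i> * c" v]
    by (simp add: F_def complex_eq_iff scaleC_scaleC)
  have F_le: "cmod (F v) \<le> p v" for v
  proof (cases "F v = 0")
    case True
    then show ?thesis
      using sublinear_minus[OF \<open>sublinear p\<close>, of v] scale[of "-1" v] by simp
  next
    case False
    \<comment> \<open>Rotate \<open>v\<close> so that \<open>F\<close> takes a nonnegative real value, which \<open>L\<close> sees.\<close>
    define c where "c = cnj (F v) / cmod (F v)"
    have "cmod c = 1"
      using False by (simp add: c_def norm_divide)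
    have "F (c *\<^sub>C v) = cmod (F v)"
      using False complex_norm_square[of "F v"]
      by (simp add: F_scale c_def field_simps power2_eq_square)
    then have "cmod (F v) = L (c *\<^sub>C v)"
      by (simp add: F_def complex_eq_iff)
    also have "\<dots> \<le> p (c *\<^sub>C v)"
      using L(2) by blast
    also have "\<dots> \<le> p v"
      using scale[of c v] \<open>cmod c = 1\<close> by simp
    finally show ?thesis .
  qed
  have "F a = p a"
  proof -
    have re: "Re (F a) = p a"
      by (simp add: F_def L(3))
    have "(cmod (F a))\<^sup>2 \<le> (p a)\<^sup>2"
      using F_le by (intro power_mono) auto
    then have "Im (F a) = 0"
      using re by (simp add: cmod_power2)
    with re show ?thesis
      by (simp add: complex_eq_iff)
  qed
  moreover have "Vector_Spaces.linear scaleC (*) F"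
    by (simp add: Vector_Spaces.linear_iff F_add F_scale complex_vector.vector_space_axioms
        vector_space_over_itself.vector_space_axioms)
  ultimately show ?thesis
    using F_le by blast
qed

section \<open>Approximate orthogonality and distance to a line\<close>

lemma dual_D:
  assumes "f \<in> dual"
  shows "bounded_linear f" and "f (v + w) = f v + f w" and "f (c *\<^sub>C v) = c * f v"
    and "f (v - w) = f v - f w" and "cmod (f v) \<le> onorm f * norm v"
  using assms onorm[of f v] unfolding dual_def
  by (auto simp: Vector_Spaces.linear_iff bounded_linear.linear linear_diff)

text \<open>
  The distance \<open>p\<close> to the line spanned by \<open>z\<close> is a seminorm below the norm, and it vanishes at \<open>z\<close>. A
  functional dominated by \<open>p\<close> that agrees with \<open>p\<close> at \<open>x\<close> has norm at most 1, kills \<open>z\<close>, and is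
  large at \<open>x\<close> because \<open>x\<close> is far from the line.
\<close>

lemma approx_orth_zero_if_far_from_line:
  assumes "0 < c" and "x \<noteq> 0" and far: "\<And>k. c * norm x \<le> norm (x - k *\<^sub>C z)"
  shows "approx_orth (1 - c) 0 x z"
proof -
  define p where "p v = (INF k. norm (v - k *\<^sub>C z))" for v
  have bdd: "bdd_below (range (\<lambda>k. norm (v - k *\<^sub>C z)))" for v
    by (intro bdd_belowI2[of _ 0]) auto
  have le: "p v \<le> norm (v - k *\<^sub>C z)" for v k
    unfolding p_def using bdd by (intro cINF_lower) auto
  have "p (v + w) \<le> p v + p w" for v w
    unfolding p_def[of v] p_def[of w]
  proof (rule le_cINF_add_cINF)
    fix k l
    have "p (v + w) \<le> norm ((v - k *\<^sub>C z) + (w - l *\<^sub>C z))"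
      using le[of "v + w" "k + l"] by (simp add: scaleC_add_left algebra_simps)
    then show "p (v + w) \<le> norm (v - k *\<^sub>C z) + norm (w - l *\<^sub>C z)"
      using norm_triangle_ineq order_trans by blast
  qed auto
  moreover have "p (c *\<^sub>C v) \<le> cmod c * p v" for c v
    unfolding p_def[of v]
  proof (rule le_mult_cINF)
    fix k
    show "p (c *\<^sub>C v) \<le> cmod c * norm (v - k *\<^sub>C z)"
      using le[of "c *\<^sub>C v" "c * k"]
      by (simp flip: norm_scaleC add: complex_vector.scale_right_diff_distrib scaleC_scaleC)
  qed (use bdd in auto)
  ultimately have "\<exists>F. Vector_Spaces.linear scaleC (*) F \<and> (\<forall>v. cmod (F v) \<le> p v) \<and> F x = p x"
    by (rule Hahn_Banach_seminorm)
  then obtain F where lin: "Vector_Spaces.linear scaleC (*) F"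
    and F_le: "\<And>v. cmod (F v) \<le> p v" and Fx: "F x = p x"
    by blast
  have F_norm: "cmod (F v) \<le> norm v" for v
    using F_le[of v] le[of v 0] by simp
  have "bounded_linear F"
    using lin F_norm by (intro bounded_linear_intro[of F 1])
      (auto simp: Vector_Spaces.linear_iff scaleR_scaleC scaleC_complex_def)
  then have "F \<in> dual"
    using lin by (simp add: dual_def)
  have px: "c * norm x \<le> p x"
    unfolding p_def using far by (intro cINF_greatest) auto
  moreover have "0 < c * norm x"
    using assms by simp
  ultimately have "0 < p x"
    by linarith
  then have "F \<noteq> (\<lambda>_. 0)"
    using Fx by force
  have "onorm F \<le> 1"
    using F_norm by (intro onorm_bound) auto
  then have "c * norm x * onorm F \<le> c * norm x"
    using assms by (intro mult_left_le) auto
  then have "c * onorm F * norm x \<le> cmod (F x)"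
    using px Fx \<open>0 < p x\<close> by (simp add: algebra_simps)
  moreover have "F z = 0"
    using order_trans[OF F_le[of z] le[of z 1]] by simp
  ultimately show ?thesis
    using \<open>F \<in> dual\<close> \<open>F \<noteq> (\<lambda>_. 0)\<close> by (auto simp: approx_orth_def)
qed

section \<open>Functionals on a plane\<close>

lemma bounded_linear_scaleC_left: "bounded_linear (\<lambda>a. a *\<^sub>C (x::'a::complex_normed_vector))"
  by (rule bounded_linear_intro[of _ "norm x"])
    (auto simp: scaleC_add_left scaleR_scaleC scaleC_scaleC norm_scaleC scaleC_complex_def)

text \<open>
  Take the largest \<open>t\<close> for which the inequality holds for all \<open>a\<close> and \<open>b\<close>; it exists because the
  case \<open>a = 1\<close>, \<open>b = 0\<close> bounds \<open>t\<close>. If the inequality were strict away from the origin, the gap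
  between the two sides would have a positive minimum on the unit sphere of coordinates, and by
  homogeneity \<open>t\<close> could still be increased. Functionals on the plane are handled through their values \<open>\<alpha>\<close>, \<open>\<beta>\<close> at \<open>x\<close>, \<open>y\<close> and
  vectors through their coordinates, so that compactness is that of a sphere in \<open>\<complex>\<^sup>2\<close>.
\<close>

lemma enlarge_functional_on_plane:
  fixes x y :: "'a::complex_normed_vector" and \<alpha> \<beta> :: complex
  assumes "\<alpha> \<noteq> 0" and bound: "\<And>a b. cmod (a * \<alpha> + b * \<beta>) \<le> norm (a *\<^sub>C x + b *\<^sub>C y)"
  obtains t a b where "1 \<le> t" and "(a, b) \<noteq> (0, 0)"
    and "\<And>a b. cmod (a * (of_real t * \<alpha>) + b * \<beta>) \<le> norm (a *\<^sub>C x + b *\<^sub>C y)"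
    and "cmod (a * (of_real t * \<alpha>) + b * \<beta>) = norm (a *\<^sub>C x + b *\<^sub>C y)"
proof -
  define g where "g t a b = norm (a *\<^sub>C x + b *\<^sub>C y) - cmod (a * (of_real t * \<alpha>) + b * \<beta>)"
    for t :: real and a b
  define T where "T = {1..} \<inter> (\<Inter>a. \<Inter>b. {t. 0 \<le> g t a b})"
  have "closed T"
    unfolding T_def g_def
    by (intro closed_Int closed_INT ballI closed_Collect_le continuous_intros)
  moreover have "bounded T"
  proof (rule boundedI)
    fix t
    assume "t \<in> T"
    then have "1 \<le> t" and "0 \<le> g t 1 0"
      by (auto simp: T_def)
    then show "norm t \<le> norm x / cmod \<alpha>"
      using \<open>\<alpha> \<noteq> 0\<close> by (simp add: g_def norm_mult field_simps)
  qed
  moreover have "1 \<in> T"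
    using bound by (simp add: T_def g_def)
  ultimately obtain t where "t \<in> T" and max: "\<And>s. s \<in> T \<Longrightarrow> s \<le> t"
    using compact_attains_sup[of T] by (auto simp: compact_eq_bounded_closed)
  then have "1 \<le> t" and g_nonneg: "0 \<le> g t a b" for a b
    by (auto simp: T_def)
  have "\<exists>a b. (a, b) \<noteq> (0, 0) \<and> g t a b \<le> 0"
  proof (rule ccontr)
    assume "\<not> ?thesis"
    then have pos: "0 < g t a b" if "(a, b) \<noteq> (0, 0)" for a b
      using that not_le by blast
    have "continuous_on (sphere 0 1) (\<lambda>u. g t (fst u) (snd u))"
      unfolding g_def
      by (intro continuous_intros bounded_linear.continuous_on[OF bounded_linear_scaleC_left])
    moreover have "(1, 0) \<in> sphere (0::complex \<times> complex) 1"
      by simp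
    then have "sphere (0::complex \<times> complex) 1 \<noteq> {}"
      by blast
    ultimately obtain u where "u \<in> sphere (0::complex \<times> complex) 1"
      and u: "\<forall>v \<in> sphere 0 1. g t (fst u) (snd u) \<le> g t (fst v) (snd v)"
      using continuous_attains_inf[OF compact_sphere] by blast
    define m where "m = g t (fst u) (snd u)"
    have "u \<noteq> 0"
      using \<open>u \<in> _\<close> by auto
    then have "0 < m"
      unfolding m_def by (intro pos) (simp add: zero_prod_def prod_eq_iff)
    \<comment> \<open>Raising \<open>t\<close> by \<open>s\<close> changes the functional on the unit sphere by at most the gap \<open>m\<close>.\<close>
    define s where "s = m / cmod \<alpha>"
    have "0 < s"
      using \<open>0 < m\<close> \<open>\<alpha> \<noteq> 0\<close> by (simp add: s_def)
    have g_scale: "g r (of_real k * a) (of_real k * b) = k * g r a b" if "0 \<le> k" for r k a b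
    proof -
      have "norm ((of_real k * a) *\<^sub>C x + (of_real k * b) *\<^sub>C y) = k * norm (a *\<^sub>C x + b *\<^sub>C y)"
        using that norm_scaleC[of "of_real k" "a *\<^sub>C x + b *\<^sub>C y"]
        by (simp add: scaleC_add_right scaleC_scaleC)
      moreover have "cmod (of_real k * a * (of_real r * \<alpha>) + of_real k * b * \<beta>)
          = k * cmod (a * (of_real r * \<alpha>) + b * \<beta>)"
        using that norm_mult[of "of_real k" "a * (of_real r * \<alpha>) + b * \<beta>"]
        by (simp add: algebra_simps)
      ultimately show ?thesis
        by (simp add: g_def algebra_simps)
    qed
    have on_sphere: "0 \<le> g (t + s) a b" if "norm (a, b) = 1" for a b
    proof -
      have "cmod a \<le> 1"
        using norm_fst_le[of a b] that by simp
      have "cmod (a * (of_real (t + s) * \<alpha>) + b * \<beta>)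
          \<le> cmod (a * (of_real t * \<alpha>) + b * \<beta>) + cmod (a * (of_real s * \<alpha>))"
        using norm_triangle_ineq[of "a * (of_real t * \<alpha>) + b * \<beta>" "a * (of_real s * \<alpha>)"]
        by (simp add: algebra_simps)
      also have "cmod (a * (of_real s * \<alpha>)) = cmod a * m"
        using \<open>0 < m\<close> \<open>\<alpha> \<noteq> 0\<close> by (simp add: norm_mult norm_divide s_def)
      also have "\<dots> \<le> m"
        using \<open>cmod a \<le> 1\<close> \<open>0 < m\<close> by simp
      also have "m \<le> g t a b"
        using bspec[OF u, of "(a, b)"] that by (simp add: m_def)
      finally show ?thesis
        by (simp add: g_def)
    qed
    have "0 \<le> g (t + s) a b" for a b
    proof (cases "(a, b) = (0, 0)")
      case True
      then show ?thesis
        by (simp add: g_def)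
    next
      case False
      define k where "k = norm (a, b)"
      have "0 < k"
        using False by (simp add: k_def zero_prod_def)
      have "norm (inverse k *\<^sub>R (a, b)) = 1"
        using \<open>0 < k\<close> unfolding norm_scaleR by (simp flip: k_def)
      then have "0 \<le> g (t + s) (of_real (inverse k) * a) (of_real (inverse k) * b)"
        by (intro on_sphere) (simp add: scaleR_conv_of_real)
      then show ?thesis
        using \<open>0 < k\<close> by (subst (asm) g_scale) (auto simp: zero_le_mult_iff)
    qed
    then have "t + s \<in> T"
      using \<open>1 \<le> t\<close> \<open>0 < s\<close> by (simp add: T_def)
    then show False
      using max \<open>0 < s\<close> by force
  qed
  then obtain a b where "(a, b) \<noteq> (0, 0)" and "g t a b = 0"
    using g_nonneg by (meson antisym)
  then show thesis
    using that[of t a b] \<open>1 \<le> t\<close> g_nonneg by (auto simp: g_def)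
qed

text \<open>
  With \<open>u\<close> a vector at which the enlarged functional \<open>g\<close> attains norm 1, subtracting
  \<open>(g y / g u) u\<close> from \<open>y\<close> is the cheapest way into the kernel of \<open>g\<close>. For \<open>z\<close> in the
  kernel, \<open>g\<close> takes the value \<open>g x\<close> on the whole line \<open>x - k z\<close>, which bounds the norm there from below.
\<close>

lemma exists_near_far_from_line:
  fixes x y :: "'a::complex_normed_vector" and \<alpha> \<beta> :: complex
  assumes "\<alpha> \<noteq> 0"
    and indep: "\<And>a b. a *\<^sub>C x + b *\<^sub>C y = 0 \<Longrightarrow> a = 0 \<and> b = 0"
    and bound: "\<And>a b. cmod (a * \<alpha> + b * \<beta>) \<le> norm (a *\<^sub>C x + b *\<^sub>C y)"
  obtains z where "z \<in> complex_vector.span {x, y}" and "norm (z - y) = cmod \<beta>"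
    and "\<And>k. cmod \<alpha> \<le> norm (x - k *\<^sub>C z)"
proof -
  obtain t a b where "1 \<le> t" and ab: "(a, b) \<noteq> (0, 0)"
    and bound': "\<And>a b. cmod (a * (of_real t * \<alpha>) + b * \<beta>) \<le> norm (a *\<^sub>C x + b *\<^sub>C y)"
    and eq: "cmod (a * (of_real t * \<alpha>) + b * \<beta>) = norm (a *\<^sub>C x + b *\<^sub>C y)"
    using enlarge_functional_on_plane[OF assms(1) bound] by blast
  define u where "u = a *\<^sub>C x + b *\<^sub>C y"
  define \<gamma> where "\<gamma> = a * (of_real t * \<alpha>) + b * \<beta>"
  define c where "c = \<beta> / \<gamma>"
  have "u \<noteq> 0"
    using ab indep unfolding u_def by blast
  then have "\<gamma> \<noteq> 0"
    using eq by (auto simp: u_def \<gamma>_def)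
  define z where "z = y - c *\<^sub>C u"
  have "z \<in> complex_vector.span {x, y}"
    unfolding z_def u_def
    by (intro complex_vector.span_diff complex_vector.span_scale complex_vector.span_add
        complex_vector.span_base) auto
  moreover have "norm (z - y) = cmod \<beta>"
    using eq \<open>u \<noteq> 0\<close> by (simp add: z_def norm_scaleC c_def norm_divide u_def \<gamma>_def)
  moreover have "cmod \<alpha> \<le> norm (x - k *\<^sub>C z)" for k
  proof -
    have "(1 + k * c * a) * (of_real t * \<alpha>) + (k * c * b - k) * \<beta>
        = of_real t * \<alpha> + k * (c * \<gamma> - \<beta>)"
      by (simp add: \<gamma>_def algebra_simps)
    also have "\<dots> = of_real t * \<alpha>"
      using \<open>\<gamma> \<noteq> 0\<close> by (simp add: c_def)
    finally have val: "(1 + k * c * a) * (of_real t * \<alpha>) + (k * c * b - k) * \<beta> = of_real t * \<alpha>" .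
    have vec: "x - k *\<^sub>C z = (1 + k * c * a) *\<^sub>C x + (k * c * b - k) *\<^sub>C y"
      by (simp add: z_def u_def algebra_simps scaleC_scaleC scaleC_add_left scaleC_add_right
          complex_vector.scale_right_diff_distrib complex_vector.scale_left_diff_distrib)
    have "cmod \<alpha> \<le> t * cmod \<alpha>"
      using \<open>1 \<le> t\<close> mult_right_mono[of 1 t "cmod \<alpha>"] by simp
    also have "\<dots> = cmod (of_real t * \<alpha>)"
      using \<open>1 \<le> t\<close> by (simp add: norm_mult)
    also have "\<dots> \<le> norm (x - k *\<^sub>C z)"
      using bound'[of "1 + k * c * a" "k * c * b - k"] unfolding val vec .
    finally show ?thesis .
  qed
  ultimately show thesis
    by (rule that)
qed

section \<open>The characterisation\<close>

theorem theorem1p6: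
  fixes x y :: "'a::complex_normed_vector" and \<epsilon> \<delta> :: real
  assumes "0 \<le> \<epsilon>" and "\<epsilon> < 1" and "0 \<le> \<delta>" and "\<delta> < 1"
    and "\<epsilon> < (1 - \<delta>)\<^sup>2"
    and "x \<noteq> 0" and "y \<noteq> 0"
  shows "approx_orth \<delta> \<epsilon> x y \<longleftrightarrow>
    (\<exists>z\<in>complex_vector.span {x, y}.
      approx_orth \<delta> 0 x z \<and> norm (z - y) \<le> \<epsilon> / (1 - \<delta>) * norm y)"
proof
  assume "approx_orth \<delta> \<epsilon> x y"
  then obtain f where f: "f \<in> dual" "f \<noteq> (\<lambda>_. 0)"
    and fx: "(1 - \<delta>) * onorm f * norm x \<le> cmod (f x)"
    and fy: "cmod (f y) \<le> \<epsilon> / (1 - \<delta>) * onorm f * norm y"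
    by (auto simp: approx_orth_def)
  define M where "M = onorm f"
  have "0 < M"
    unfolding M_def using onorm_pos_lt[OF dual_D(1)[OF f(1)]] f(2) by blast
  define \<alpha> where "\<alpha> = f x / M"
  define \<beta> where "\<beta> = f y / M"
  have \<alpha>: "(1 - \<delta>) * norm x \<le> cmod \<alpha>"
    using fx \<open>0 < M\<close> by (simp add: \<alpha>_def norm_divide field_simps flip: M_def)
  have \<beta>: "cmod \<beta> \<le> \<epsilon> / (1 - \<delta>) * norm y"
    using fy \<open>0 < M\<close> by (simp add: \<beta>_def norm_divide field_simps flip: M_def)
  have bound: "cmod (a * \<alpha> + b * \<beta>) \<le> norm (a *\<^sub>C x + b *\<^sub>C y)" for a b
  proof -
    have "a * \<alpha> + b * \<beta> = f (a *\<^sub>C x + b *\<^sub>C y) / M"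
      by (simp add: \<alpha>_def \<beta>_def dual_D[OF f(1)] add_divide_distrib)
    then have "cmod (a * \<alpha> + b * \<beta>) = cmod (f (a *\<^sub>C x + b *\<^sub>C y)) / M"
      using \<open>0 < M\<close> by (simp add: norm_divide)
    also have "\<dots> \<le> norm (a *\<^sub>C x + b *\<^sub>C y)"
      using dual_D(5)[OF f(1), of "a *\<^sub>C x + b *\<^sub>C y"] \<open>0 < M\<close>
      by (simp add: pos_divide_le_eq mult.commute flip: M_def)
    finally show ?thesis .
  qed
  have "0 < (1 - \<delta>) * norm x"
    using assms by simp
  with \<alpha> have "\<alpha> \<noteq> 0"
    by auto
  have "\<epsilon> / (1 - \<delta>) < 1 - \<delta>"
    using assms by (simp add: field_simps power2_eq_square)
  then have small: "\<epsilon> / (1 - \<delta>) * norm y < (1 - \<delta>) * norm y"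
    using \<open>y \<noteq> 0\<close> by (intro mult_strict_right_mono) auto
  \<comment> \<open>On a line containing both, the ratio of \<open>|f| / M\<close> to the norm would be the same at \<open>x\<close> and \<open>y\<close>,
    but it is at least \<open>1 - \<delta>\<close> at \<open>x\<close> and less than that at \<open>y\<close>.\<close>
  have indep: "a = 0 \<and> b = 0" if zero: "a *\<^sub>C x + b *\<^sub>C y = 0" for a b
  proof (cases "b = 0")
    case True
    then show ?thesis
      using zero \<open>x \<noteq> 0\<close> by simp
  next
    case False
    have "norm (a *\<^sub>C x) = norm (b *\<^sub>C y)"
      using zero by (metis add_eq_0_iff norm_minus_cancel)
    moreover have "cmod (a * \<alpha>) = cmod (b * \<beta>)"
      using bound[of a b] zero by (metis add_eq_0_iff norm_le_zero_iff norm_minus_cancel norm_zero)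
    ultimately have norms: "cmod a * norm x = cmod b * norm y" "cmod a * cmod \<alpha> = cmod b * cmod \<beta>"
      by (simp_all add: norm_scaleC norm_mult)
    have "cmod b * ((1 - \<delta>) * norm y) = cmod a * ((1 - \<delta>) * norm x)"
      using norms(1) by (simp add: algebra_simps)
    also have "\<dots> \<le> cmod a * cmod \<alpha>"
      using \<alpha> by (intro mult_left_mono) auto
    also have "\<dots> = cmod b * cmod \<beta>"
      by (rule norms(2))
    finally have "(1 - \<delta>) * norm y \<le> cmod \<beta>"
      using False by simp
    then show ?thesis
      using \<beta> small by simp
  qed
  obtain z where z: "z \<in> complex_vector.span {x, y}" "norm (z - y) = cmod \<beta>"
    and "\<And>k. cmod \<alpha> \<le> norm (x - k *\<^sub>C z)"
    using exists_near_far_from_line[OF \<open>\<alpha> \<noteq> 0\<close> indep bound] by blast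
  then have "(1 - \<delta>) * norm x \<le> norm (x - k *\<^sub>C z)" for k
    using \<alpha> order_trans by blast
  then have "approx_orth \<delta> 0 x z"
    using approx_orth_zero_if_far_from_line[of "1 - \<delta>" x z] assms by simp
  then show "\<exists>z\<in>complex_vector.span {x, y}.
      approx_orth \<delta> 0 x z \<and> norm (z - y) \<le> \<epsilon> / (1 - \<delta>) * norm y"
    using z \<beta> by auto
next
  assume "\<exists>z\<in>complex_vector.span {x, y}.
      approx_orth \<delta> 0 x z \<and> norm (z - y) \<le> \<epsilon> / (1 - \<delta>) * norm y"
  then obtain z f where z: "norm (z - y) \<le> \<epsilon> / (1 - \<delta>) * norm y"
    and f: "f \<in> dual" "f \<noteq> (\<lambda>_. 0)" "(1 - \<delta>) * onorm f * norm x \<le> cmod (f x)" "f z = 0"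
    by (auto simp: approx_orth_def)
  have "cmod (f y) = cmod (f (z - y))"
    by (simp add: dual_D(4)[OF f(1)] f(4))
  also have "\<dots> \<le> onorm f * norm (z - y)"
    by (rule dual_D(5)[OF f(1)])
  also have "\<dots> \<le> onorm f * (\<epsilon> / (1 - \<delta>) * norm y)"
    using z by (intro mult_left_mono onorm_pos_le dual_D(1)[OF f(1)])
  finally show "approx_orth \<delta> \<epsilon> x y"
    using f by (auto simp: approx_orth_def algebra_simps)
qed

end
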